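(* Let $Z=(Z_n)_{n\in\mathbb{N}_0}$ be a Galton–Watson process with $Z_0=1$, $Z_{n+1}=\sum_{i=1}^{Z_n}Y_{i,n+1}$, where $(Y_{i,n})_{i,n\geq1}$ are i.i.d. $\mathbb{N}_0$-valued offspring variables with mean $\mathfrak{m}:=\mathbb{E}[Y_{1,1}]\in(0,1)$ and variance $v:=\operatorname{Var}(Y_{1,1})\in[0,\infty]$. Let $K>0$, and define $$\mathcal{O}_K:=\sum_{n\in\mathbb{N}}\mathbf{1}\{Z_n\geq K\},\qquad\mathbf{m}_K:=\max\{n\in\mathbb{N}:Z_n\geq K\}.$$ Then for all $k\geq1$ $$\mathbb{P}(\mathcal{O}_K\geq k)\leq\mathbb{P}(\mathbf{m}_K\geq k)\leq\frac{2e^{9/8}}{\mathfrak{m}(1-\mathfrak{m})K}\cdot\Big[k\Big(\Big(\frac{v}{\mathfrak{m}(1-\mathfrak{m})K}\wedge1\Big)+1\Big)+1\Big]\cdot\mathfrak{m}^k.$$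
   Context: $\mathbb{N}=\{1,2,\dots\}$, $\mathbb{N}_0=\mathbb{N}\cup\{0\}$; $x\wedge y=\min\{x,y\}$; $\max\emptyset:=0$ and the maximum of an infinite set is $\infty$. *)

theory Defs
  imports "HOL-Probability.Probability"
begin

text \<open>
  \<open>Y i n\<close> is the number of children of individual \<open>i\<close> of generation \<open>n - 1\<close>; only indices
  \<open>i, n \<ge> 1\<close> are used.
\<close>

primrec gw :: "(nat \<Rightarrow> nat \<Rightarrow> 'a \<Rightarrow> nat) \<Rightarrow> nat \<Rightarrow> 'a \<Rightarrow> nat" where
  "gw Y 0 \<omega> = 1"
| "gw Y (Suc n) \<omega> = (\<Sum>i = 1..gw Y n \<omega>. Y i (Suc n) \<omega>)"

text \<open>
  The library's \<open>variance\<close> is a Bochner integral and is \<open>0\<close> when the second moment is infinite;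
  here an infinite variance has to be \<open>\<infinity>\<close>.
\<close>

definition ext_variance :: "'a measure \<Rightarrow> ('a \<Rightarrow> real) \<Rightarrow> ennreal" where
  "ext_variance M X = (\<integral>\<^sup>+\<omega>. ennreal ((X \<omega> - (\<integral>\<omega>'. X \<omega>' \<partial>M))\<^sup>2) \<partial>M)"

definition ext_Max :: "nat set \<Rightarrow> enat" where
  "ext_Max A = (if infinite A then \<infinity> else if A = {} then 0 else enat (Max A))"

definition occupation_time :: "(nat \<Rightarrow> 'a \<Rightarrow> nat) \<Rightarrow> real \<Rightarrow> 'a \<Rightarrow> enat" where
  "occupation_time Z K \<omega> = (\<Sum>\<^sub>\<infinity>n\<in>{1..}. of_bool (real (Z n \<omega>) \<ge> K))"

definition last_time :: "(nat \<Rightarrow> 'a \<Rightarrow> nat) \<Rightarrow> real \<Rightarrow> 'a \<Rightarrow> enat" where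
  "last_time Z K \<omega> = ext_Max {n. n \<ge> 1 \<and> real (Z n \<omega>) \<ge> K}"

end

theory Submission
  imports Defs
begin

text \<open>
  Since \<open>\<bbbE>[Z\<^sub>n] = m ^ n\<close>, Markov's inequality and a union bound over \<open>n \<ge> k\<close> already give
  \<open>\<bbbP>(last_time \<ge> k) \<le> m ^ k / ((1 - m) K)\<close>, which lies below the stated bound because
  \<open>2 exp (9 / 8) / m\<close> and the bracket are both at least \<open>1\<close>.
\<close>

text \<open>Used to evaluate \<open>gw Y n\<close> on a family restricted to generations
  \<open>1..n\<close>. The points \<open>x\<close> and \<open>y\<close> may lie in different sample
  spaces.\<close>

lemma gw_cong:
  assumes "\<And>i l. 1 \<le> i \<Longrightarrow> 1 \<le> l \<Longrightarrow> l \<le> n \<Longrightarrow> Y i l x = Y' i l y"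
  shows "gw Y n x = gw Y' n y"
  using assms by (induction n) auto

text \<open>The measure \<open>N\<close> is arbitrary because the lemma serves both \<open>M\<close>
  and a product space of offspring counts.\<close>

lemma measurable_gw:
  assumes "\<And>i l. 1 \<le> i \<Longrightarrow> 1 \<le> l \<Longrightarrow> l \<le> n \<Longrightarrow> Y i l \<in> measurable N (count_space UNIV)"
  shows "gw Y n \<in> measurable N (count_space UNIV)"
  using assms
proof (induction n)
  case 0
  then show ?case by (simp cong: measurable_cong)
next
  case (Suc n)
  note meas = Suc.prems
  have "(\<lambda>\<omega>. \<Sum>i = 1..j. Y i (Suc n) \<omega>) \<in> measurable N (count_space UNIV)" for j
  proof (induction j)
    case (Suc j)
    have [measurable]: "Y (Suc j) (Suc n) \<in> measurable N (count_space UNIV)"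
      by (rule meas) auto
    from Suc show ?case by simp
  qed simp
  moreover have "gw Y n \<in> measurable N (count_space UNIV)"
    using Suc by simp
  \<comment> \<open>The upper summation limit is random but takes countably many values, so
    measurability for each fixed limit \<open>j\<close> suffices.\<close>
  ultimately have "(\<lambda>\<omega>. (\<lambda>j \<omega>. \<Sum>i = 1..j. Y i (Suc n) \<omega>) (gw Y n \<omega>) \<omega>)
      \<in> measurable N (count_space UNIV)"
    by (rule measurable_compose_countable)
  then show ?case
    by (simp cong: measurable_cong)
qed

text \<open>Generation \<open>n\<close> is a function of the offspring variables of generations
  \<open>1..n\<close>, an index block disjoint from \<open>(i, Suc n)\<close>.\<close>

lemma (in prob_space) indep_var_gw_offspring:
  assumes ind: "indep_vars (\<lambda>_. count_space UNIV) (\<lambda>(i, n). Y i n) ({1..} \<times> {1..})"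
    and "1 \<le> i"
  shows "indep_var (count_space UNIV) (gw Y n) (count_space UNIV) (Y i (Suc n))"
proof -
  let ?A = "{1..} \<times> {1..n}" and ?B = "{(i, Suc n)}"
  let ?C = "\<lambda>_::nat \<times> nat. count_space (UNIV :: nat set)"
  let ?X = "\<lambda>S \<omega>. restrict (\<lambda>p. (case p of (i, n) \<Rightarrow> Y i n) \<omega>) S"
  \<comment> \<open>This is the process driven by the coordinate maps of the product space; composed
    with the restricted family it gives back \<open>gw Y n\<close>.\<close>
  have "gw (\<lambda>i l x. x (i, l)) n \<in> measurable (PiM ?A ?C) (count_space UNIV)"
    by (rule measurable_gw) (auto intro!: measurable_component_singleton)
  moreover have "(\<lambda>x. x (i, Suc n)) \<in> measurable (PiM ?B ?C) (count_space UNIV)"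
    by (rule measurable_component_singleton) simp
  moreover have "indep_var (PiM ?A ?C) (?X ?A) (PiM ?B ?C) (?X ?B)"
    using \<open>1 \<le> i\<close> by (intro indep_var_restrict[OF ind]) auto
  ultimately have "indep_var (count_space UNIV) (gw (\<lambda>i l x. x (i, l)) n \<circ> ?X ?A)
      (count_space UNIV) ((\<lambda>x. x (i, Suc n)) \<circ> ?X ?B)"
    by (intro indep_var_compose)
  moreover have "gw (\<lambda>i l x. x (i, l)) n \<circ> ?X ?A = gw Y n"
    by (auto simp: fun_eq_iff intro!: gw_cong)
  moreover have "(\<lambda>x. x (i, Suc n)) \<circ> ?X ?B = Y i (Suc n)"
    by (auto simp: fun_eq_iff)
  ultimately show ?thesis by simp
qed

lemma (in prob_space) indep_var_nn_integral_mult: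
  fixes X X' :: "'a \<Rightarrow> ennreal"
  assumes "indep_var borel X borel X'"
  shows "(\<integral>\<^sup>+\<omega>. X \<omega> * X' \<omega> \<partial>M) = (\<integral>\<^sup>+\<omega>. X \<omega> \<partial>M) * (\<integral>\<^sup>+\<omega>. X' \<omega> \<partial>M)"
proof -
  \<comment> \<open>\<open>indep_var\<close> is independence of a family indexed by
    \<open>bool\<close>; the product rule for integrals wants its target spaces as a constant
    function.\<close>
  have *: "case_bool borel borel = (\<lambda>_. borel :: ennreal measure)"
    by (auto split: bool.split)
  have "indep_vars (\<lambda>_. borel) (case_bool X X') UNIV"
    using assms unfolding indep_var_def * .
  then have "(\<integral>\<^sup>+\<omega>. (\<Prod>b\<in>UNIV. case_bool X X' b \<omega>) \<partial>M) = (\<Prod>b\<in>UNIV. \<integral>\<^sup>+\<omega>. case_bool X X' b \<omega> \<partial>M)"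
    by (intro indep_vars_nn_integral) auto
  then show ?thesis
    by (simp add: UNIV_bool mult.commute)
qed

text \<open>Trades a sum with a random upper limit for a series over a fixed range, so that the
  expectation can be moved inside.\<close>

lemma suminf_of_bool_less:
  fixes f :: "nat \<Rightarrow> ennreal"
  shows "(\<Sum>i. of_bool (i < N) * f i) = (\<Sum>i<N. f i)"
  by (subst suminf_finite[of "{..<N}"]) auto

text \<open>Wald's identity in each generation: the expectation of the next generation is the sum
  over \<open>i\<close> of P(Z_n > i) times \<open>\<mu>\<close>, which is \<open>\<mu>\<close>
  times the expectation of Z_n. Working in \<open>ennreal\<close> avoids integrability
  questions.\<close>

lemma (in prob_space) nn_integral_gw:
  assumes ind: "indep_vars (\<lambda>_. count_space UNIV) (\<lambda>(i, n). Y i n) ({1..} \<times> {1..})"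
    and mean: "\<And>i n. 1 \<le> i \<Longrightarrow> 1 \<le> n \<Longrightarrow> (\<integral>\<^sup>+\<omega>. of_nat (Y i n \<omega>) \<partial>M) = \<mu>"
  shows "(\<integral>\<^sup>+\<omega>. of_nat (gw Y n \<omega>) \<partial>M) = \<mu> ^ n"
proof (induction n)
  case 0
  then show ?case by (simp add: emeasure_space_1)
next
  case (Suc n)
  \<comment> \<open>Writing the indices as successors frees the rule of side conditions, so the
    measurability prover can apply it.\<close>
  have Y[measurable]: "Y (Suc i) (Suc l) \<in> measurable M (count_space UNIV)" for i l
  proof -
    have "(\<lambda>(i, n). Y i n) (Suc i, Suc l) \<in> measurable M (count_space UNIV)"
      using ind unfolding indep_vars_def
      by (metis (no_types, lifting) SigmaI atLeast_iff le_add1 plus_1_eq_Suc)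
    then show ?thesis by simp
  qed
  have [measurable]: "gw Y n \<in> measurable M (count_space UNIV)"
  proof (rule measurable_gw)
    show "Y i l \<in> measurable M (count_space UNIV)" if "1 \<le> i" "1 \<le> l" for i l
      using that Y[of "i - 1" "l - 1"] by simp
  qed
  have "of_nat (gw Y (Suc n) \<omega>)
      = (\<Sum>i. of_bool (i < gw Y n \<omega>) * of_nat (Y (Suc i) (Suc n) \<omega>) :: ennreal)" for \<omega>
    unfolding suminf_of_bool_less
    by (simp add: sum.atLeast1_atMost_eq lessThan_Suc_atMost)
  then have "(\<integral>\<^sup>+\<omega>. of_nat (gw Y (Suc n) \<omega>) \<partial>M)
      = (\<integral>\<^sup>+\<omega>. (\<Sum>i. of_bool (i < gw Y n \<omega>) * of_nat (Y (Suc i) (Suc n) \<omega>)) \<partial>M)"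
    by presburger
  also have "\<dots> = (\<Sum>i. \<integral>\<^sup>+\<omega>. of_bool (i < gw Y n \<omega>) * of_nat (Y (Suc i) (Suc n) \<omega>) \<partial>M)"
    by (rule nn_integral_suminf) measurable
  also have "\<dots> = (\<Sum>i. (\<integral>\<^sup>+\<omega>. of_bool (i < gw Y n \<omega>) \<partial>M) * \<mu>)"
  \<comment> \<open>Whether individual \<open>Suc i\<close> exists is decided by generation
    \<open>n\<close>, hence independent of its number of children.\<close>
  proof (rule suminf_cong)
    fix i
    have "indep_var borel ((\<lambda>z. of_bool (i < z) :: ennreal) \<circ> gw Y n)
        borel (of_nat \<circ> Y (Suc i) (Suc n))"
      by (rule indep_var_compose[OF indep_var_gw_offspring[OF ind]]) auto
    from indep_var_nn_integral_mult[OF this]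
    show "(\<integral>\<^sup>+\<omega>. of_bool (i < gw Y n \<omega>) * of_nat (Y (Suc i) (Suc n) \<omega>) \<partial>M)
        = (\<integral>\<^sup>+\<omega>. of_bool (i < gw Y n \<omega>) \<partial>M) * \<mu>"
      by (simp add: mean)
  qed
  \<comment> \<open>Moving the sum back inside recovers Z_n, as it equals the number of
    \<open>i\<close> with \<open>i < gw Y n \<omega>\<close>.\<close>
  also have "\<dots> = (\<integral>\<^sup>+\<omega>. (\<Sum>i. of_bool (i < gw Y n \<omega>)) \<partial>M) * \<mu>"
    by (simp add: nn_integral_suminf)
  also have "(\<lambda>\<omega>. \<Sum>i. of_bool (i < gw Y n \<omega>) :: ennreal) = (\<lambda>\<omega>. of_nat (gw Y n \<omega>))"
    using suminf_of_bool_less[of _ "\<lambda>_. 1"] by simp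
  finally show ?case
    by (simp add: Suc mult.commute)
qed

text \<open>The condition \<open>1 \<le> k\<close> excludes the value \<open>0\<close> given to the
  empty set and makes the restriction to positive times automatic. An infinite set contains times
  beyond every \<open>k\<close>.\<close>

lemma enat_le_last_time_iff:
  assumes "1 \<le> k"
  shows "enat k \<le> last_time Z K \<omega> \<longleftrightarrow> (\<exists>n\<ge>k. K \<le> real (Z n \<omega>))"
proof -
  let ?A = "{n. 1 \<le> n \<and> K \<le> real (Z n \<omega>)}"
  consider "infinite ?A" | "?A = {}" | "finite ?A" "?A \<noteq> {}" by blast
  then show ?thesis
  proof cases
    case 1
    then have "\<exists>n\<ge>k. n \<in> ?A"
      by (meson infinite_nat_iff_unbounded_le)
    with 1 show ?thesis by (auto simp: last_time_def ext_Max_def)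
  next
    case 2
    then have "\<not> (\<exists>n\<ge>k. K \<le> real (Z n \<omega>))"
      using assms by fastforce
    with 2 assms show ?thesis
      by (simp add: last_time_def ext_Max_def enat_0_iff(1) del: Collect_empty_eq)
  next
    case 3
    then have "enat k \<le> last_time Z K \<omega> \<longleftrightarrow> (\<exists>n\<in>?A. k \<le> n)"
      unfolding last_time_def ext_Max_def by (simp add: Max_ge_iff del: Collect_empty_eq)
    then show ?thesis using assms by fastforce
  qed
qed

text \<open>A finite nonempty set of positive integers lies in \<open>{1..Max A}\<close>, so its
  size is at most its maximum; starting at time \<open>1\<close> rather than \<open>0\<close>
  matters. For an infinite set the right side is \<open>\<infinity>\<close>.\<close>

lemma occupation_time_le_last_time: "occupation_time Z K \<omega> \<le> last_time Z K \<omega>"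
proof -
  let ?A = "{n. 1 \<le> n \<and> K \<le> real (Z n \<omega>)}"
  show ?thesis
  proof (cases "finite ?A")
    case True
    have "occupation_time Z K \<omega> = infsum (\<lambda>_. 1) ?A"
      unfolding occupation_time_def by (rule infsum_cong_neutral) auto
    also have "\<dots> = enat (card ?A)"
      using True by (simp add: of_nat_eq_enat)
    also have "\<dots> \<le> last_time Z K \<omega>"
    proof (cases "?A = {}")
      case False
      have "?A \<subseteq> {1..Max ?A}" using True by auto
      then have "card ?A \<le> card {1..Max ?A}"
        by (rule card_mono[rotated]) simp
      then show ?thesis
        using True False by (simp add: last_time_def ext_Max_def del: Collect_empty_eq)
    qed (simp only: card.empty zero_enat_def[symmetric] zero_le)
    finally show ?thesis .
  qed (simp add: last_time_def ext_Max_def)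
qed

theorem lemma3:
  fixes M :: "'a measure" and Y :: "nat \<Rightarrow> nat \<Rightarrow> 'a \<Rightarrow> nat"
    and m K :: real and v :: ennreal and k :: nat
  assumes "prob_space M"
    and "prob_space.indep_vars M (\<lambda>_. count_space UNIV) (\<lambda>(i, n). Y i n) ({1..} \<times> {1..})"
    and "\<And>i n. i \<ge> 1 \<Longrightarrow> n \<ge> 1 \<Longrightarrow>
           distr M (count_space UNIV) (Y i n) = distr M (count_space UNIV) (Y 1 1)"
    and "integrable M (\<lambda>\<omega>. real (Y 1 1 \<omega>))"
    and "m = (\<integral>\<omega>. real (Y 1 1 \<omega>) \<partial>M)" and "0 < m" and "m < 1"
    and "v = ext_variance M (\<lambda>\<omega>. real (Y 1 1 \<omega>))"
    and "K > 0" and "k \<ge> 1"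
  shows "measure M {\<omega> \<in> space M. occupation_time (gw Y) K \<omega> \<ge> enat k}
           \<le> measure M {\<omega> \<in> space M. last_time (gw Y) K \<omega> \<ge> enat k}
       \<and> measure M {\<omega> \<in> space M. last_time (gw Y) K \<omega> \<ge> enat k}
           \<le> 2 * exp (9 / 8) / (m * (1 - m) * K)
             * (real k * (enn2real (min (v / ennreal (m * (1 - m) * K)) 1) + 1) + 1) * m ^ k"
proof -
  interpret prob_space M by fact
  note ind = \<open>indep_vars _ _ _\<close>
  have Y: "Y i n \<in> measurable M (count_space UNIV)" if "1 \<le> i" "1 \<le> n" for i n
  proof -
    have "(\<lambda>(i, n). Y i n) (i, n) \<in> measurable M (count_space UNIV)"
      using ind that unfolding indep_vars_def by blast
    then show ?thesis by simp
  qed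
  have gw[measurable]: "gw Y n \<in> measurable M (count_space UNIV)" for n
    by (rule measurable_gw) (rule Y)
  have mean: "(\<integral>\<^sup>+\<omega>. of_nat (Y i n \<omega>) \<partial>M) = ennreal m" if "1 \<le> i" "1 \<le> n" for i n
  proof -
    \<comment> \<open>Equality of distributions is assumed for push-forward measures, so the means
      are compared through them.\<close>
    have distr: "(\<integral>\<^sup>+x. of_nat x \<partial>distr M (count_space UNIV) (Y j l)) = (\<integral>\<^sup>+\<omega>. of_nat (Y j l \<omega>) \<partial>M)"
      if "1 \<le> j" "1 \<le> l" for j l
      by (rule nn_integral_distr) (use Y that in auto)
    have "(\<integral>\<^sup>+\<omega>. of_nat (Y i n \<omega>) \<partial>M) = (\<integral>\<^sup>+\<omega>. of_nat (Y 1 1 \<omega>) \<partial>M)"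
      using distr[OF that] distr[of 1 1] assms(3)[OF that] by simp
    also have "\<dots> = (\<integral>\<^sup>+\<omega>. ennreal (real (Y 1 1 \<omega>)) \<partial>M)"
      by (simp add: ennreal_of_nat_eq_real_of_nat)
    also have "\<dots> = ennreal m"
      unfolding \<open>m = _\<close> using assms(4) by (intro nn_integral_eq_integral) auto
    finally show ?thesis .
  qed
  let ?L = "{\<omega> \<in> space M. last_time (gw Y) K \<omega> \<ge> enat k}"
  let ?E = "\<lambda>n. {\<omega> \<in> space M. K \<le> real (gw Y n \<omega>)}"
  \<comment> \<open>The countable union yields both measurability of the event and the union
    bound.\<close>
  have L: "?L = (\<Union>n. ?E (n + k))"
  proof -
    have "(\<exists>n\<ge>k. K \<le> real (gw Y n \<omega>)) \<longleftrightarrow> (\<exists>n. K \<le> real (gw Y (n + k) \<omega>))" for \<omega>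
      by (metis le_add2 le_add_diff_inverse2)
    then show ?thesis
      by (auto simp: enat_le_last_time_iff[OF \<open>1 \<le> k\<close>])
  qed
  have "measure M {\<omega> \<in> space M. occupation_time (gw Y) K \<omega> \<ge> enat k} \<le> measure M ?L"
  proof (rule finite_measure_mono)
    \<comment> \<open>Only the larger set has to be an event here; \<open>measure\<close> is
      \<open>0\<close> on sets that are not events.\<close>
    show "?L \<in> events" unfolding L by measurable
  qed (auto intro: order_trans[OF _ occupation_time_le_last_time])
  moreover have "measure M ?L \<le> 2 * exp (9 / 8) / (m * (1 - m) * K)
      * (real k * (enn2real (min (v / ennreal (m * (1 - m) * K)) 1) + 1) + 1) * m ^ k"
    (is "_ \<le> ?C / _ * ?B * _")
  proof -
    have markov: "emeasure M (?E n) \<le> ennreal (m ^ n / K)" for n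
    proof -
      \<comment> \<open>Dividing by \<open>K\<close> puts the event in the form of Markov's
        inequality, with constant \<open>1 / K\<close>.\<close>
      have "?E n = {\<omega> \<in> space M. 1 \<le> ennreal (1 / K) * of_nat (gw Y n \<omega>)}"
        using \<open>K > 0\<close>
        by (auto simp: ennreal_of_nat_eq_real_of_nat ennreal_mult[symmetric] field_simps)
      then have "emeasure M (?E n)
          \<le> ennreal (1 / K) * (\<integral>\<^sup>+\<omega>. of_nat (gw Y n \<omega>) * indicator (space M) \<omega> \<partial>M)"
        by (simp only:) (rule nn_integral_Markov_inequality; measurable)
      also have "(\<integral>\<^sup>+\<omega>. of_nat (gw Y n \<omega>) * indicator (space M) \<omega> \<partial>M) = ennreal m ^ n"
        using nn_integral_gw[OF ind mean, of n] by (simp cong: nn_integral_cong)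
      finally show ?thesis
        using \<open>K > 0\<close> \<open>0 < m\<close> by (simp add: ennreal_power ennreal_mult[symmetric])
    qed
    have "emeasure M ?L \<le> (\<Sum>n. emeasure M (?E (n + k)))"
      unfolding L by (rule emeasure_subadditive_countably) auto
    also have "\<dots> \<le> (\<Sum>n. ennreal (m ^ (n + k) / K))"
      by (intro suminf_le markov) auto
    also have "\<dots> = ennreal (m ^ k / ((1 - m) * K))"
    proof (rule suminf_ennreal_eq)
      have "(\<lambda>n. m ^ n * (m ^ k / K)) sums (1 / (1 - m) * (m ^ k / K))"
        using \<open>0 < m\<close> \<open>m < 1\<close> by (intro sums_mult2 geometric_sums) auto
      then show "(\<lambda>n. m ^ (n + k) / K) sums (m ^ k / ((1 - m) * K))"
        by (simp add: power_add)
    qed (use \<open>0 < m\<close> \<open>K > 0\<close> in simp)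
    finally have "measure M ?L \<le> 1 / ((1 - m) * K) * m ^ k"
      using \<open>0 < m\<close> \<open>m < 1\<close> \<open>K > 0\<close> by (simp add: emeasure_eq_measure)
    also have "\<dots> \<le> ?C / (m * (1 - m) * K) * ?B * m ^ k"
    proof (rule mult_right_mono)
      \<comment> \<open>What remains after removing the common factors
        \<open>1 / ((1 - m) * K)\<close> and \<open>m ^ k\<close>. The first factor uses
        \<open>m < 1 \<le> exp (9 / 8)\<close>; the bracket is \<open>1\<close> plus a nonnegative
        term, since \<open>enn2real\<close> is nonnegative.\<close>
      have "1 * 1 \<le> (?C / m) * ?B"
      proof (rule mult_mono)
        have "m \<le> ?C"
          using \<open>m < 1\<close> one_le_exp_iff[of "9 / 8 :: real"] by linarith
        then show "1 \<le> ?C / m" using \<open>0 < m\<close> by simp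
      qed (use \<open>0 < m\<close> in simp_all)
      then have "1 * 1 / ((1 - m) * K) \<le> ?C / m * ?B / ((1 - m) * K)"
        using \<open>m < 1\<close> \<open>K > 0\<close> by (intro divide_right_mono) auto
      then show "1 / ((1 - m) * K) \<le> ?C / (m * (1 - m) * K) * ?B"
        by (simp add: mult.assoc)
    qed (use \<open>0 < m\<close> in simp)
    finally show ?thesis .
  qed
  ultimately show ?thesis ..
qed

end
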